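(* Let $\overline{\mathrm{m}}:\mathbb{R}\to\mathbb{R}$ be odd and twice continuously differentiable, and let the time-dependent magnetic field $\boldsymbol{B}(\boldsymbol{r},t)\in\mathbb{R}^3$ be differentiable and parallel to its velocity field. Then the time derivative of the magnetization $\overline{\boldsymbol{M}}(\boldsymbol{B}(\boldsymbol{r},t))=\overline{\mathrm{m}}(|\boldsymbol{B}(\boldsymbol{r},t)|)\,\frac{\boldsymbol{B}(\boldsymbol{r},t)}{|\boldsymbol{B}(\boldsymbol{r},t)|}$ is given by $$\frac{\mathrm{d}}{\mathrm{d}t}\overline{\boldsymbol{M}}(\boldsymbol{B}(\boldsymbol{r},t))=\overline{\mathrm{m}}'(|\boldsymbol{B}(\boldsymbol{r},t)|)\,\frac{\mathrm{d}}{\mathrm{d}t}\boldsymbol{B}(\boldsymbol{r},t)$$ (for all $\boldsymbol{r}\in\Omega$ and all times $t$, including those with $\boldsymbol{B}(\boldsymbol{r},t)=\boldsymbol{0}$). In particular, the general imaging model $$u_\nu(t)=-\mu_0\frac{\mathrm{d}}{\mathrm{d}t}\int_{\Omega}\big\langle\boldsymbol{\varrho}_\nu(\boldsymbol{r}),\overline{\boldsymbol{M}}(\boldsymbol{B}(\boldsymbol{r},t))\big\rangle\,c(\boldsymbol{r})\,\mathrm{d}\boldsymbol{r}$$ can be rewritten as $$u_\nu(t)=-\mu_0\int_{\Omega}\Big\langle\boldsymbol{\varrho}_\nu(\boldsymbol{r}),\frac{\mathrm{d}}{\mathrm{d}t}\boldsymbol{B}(\boldsymbol{r},t)\Big\r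angle\,\overline{\mathrm{m}}'(|\boldsymbol{B}(\boldsymbol{r},t)|)\,c(\boldsymbol{r})\,\mathrm{d}\boldsymbol{r}.$$
   Context: $\Omega\subset\mathbb{R}^3$ is the spatial domain, $|\cdot|$ and $\langle\cdot,\cdot\rangle$ are the Euclidean norm and inner product on $\mathbb{R}^3$, and $\frac{\mathrm{d}}{\mathrm{d}t}\boldsymbol{B}(\boldsymbol{r},t)$ denotes the time derivative at fixed $\boldsymbol{r}$ (the velocity field of $\boldsymbol{B}$). The field $\boldsymbol{B}$ is called parallel to its velocity field if, for all $\boldsymbol{r}\in\Omega$ and all times $t$, the vectors $\boldsymbol{B}(\boldsymbol{r},t)$ and $\frac{\mathrm{d}}{\mathrm{d}t}\boldsymbol{B}(\boldsymbol{r},t)$ are parallel, i.e. linearly dependent (the velocity points in the same or the reversed direction of the field; the zero vector counts as parallel to every vector). The magnetization $\overline{\boldsymbol{M}}(\boldsymbol{B})=\overline{\mathrm{m}}(|\boldsymbol{B}|)\boldsymbol{B}/|\boldsymbol{B}|$ is extended continuously to $\boldsymbol{B}=\boldsymbol{0}$ by $\overline{\boldsymbol{M}}(\boldsymbol{0})=\boldsymbol{0}$, equivalently by giving $\overline{\mathrm{m}}(x)/x$ the value $\overline{\mathrm{m}}'(0)$ at $x=0$. The constant $\mu_0>0$ is the permeability of free space, $\boldsymbol{\varrho}_\nu:\Omega\to\mathbb{R}^3$ is the sensitivity of the receive coil $\nu\in\{1,\dots,V\}$, $c:\Omega\to\mathbb{R}$ is the particle density, and $u_\nu(t)$ is the voltage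 induced in coil $\nu$. For the second assertion it is understood that the data $\boldsymbol{\varrho}_\nu$, $c$, $\boldsymbol{B}$ are such that the integrals exist and the time derivative may be interchanged with the integral over $\Omega$. *)

theory Defs
  imports "HOL-Analysis.Analysis"
begin

definition odd_function :: "(real \<Rightarrow> real) \<Rightarrow> bool" where
  "odd_function m \<longleftrightarrow> (\<forall>x. m (- x) = - m x)"

definition twice_continuously_differentiable :: "(real \<Rightarrow> real) \<Rightarrow> bool" where
  "twice_continuously_differentiable m \<longleftrightarrow>
     m C1_differentiable_on UNIV \<and> deriv m C1_differentiable_on UNIV"

(* Not the library's "dependent {v, w}": that set collapses to a singleton when v = w,
   and would then count equal nonzero vectors as independent. *)
definition parallel :: "'a::real_vector \<Rightarrow> 'a \<Rightarrow> bool" where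
  "parallel v w \<longleftrightarrow> (\<exists>a b. (a \<noteq> 0 \<or> b \<noteq> 0) \<and> a *\<^sub>R v + b *\<^sub>R w = 0)"

(* Time derivative at fixed position. The set T of times is a nondegenerate interval, so the
   derivative is unique; it is one-sided at endpoints belonging to T and two-sided elsewhere. *)
definition time_derivative ::
    "real set \<Rightarrow> ('r \<Rightarrow> real \<Rightarrow> 'b::real_normed_vector) \<Rightarrow> 'r \<Rightarrow> real \<Rightarrow> 'b" where
  "time_derivative T F r t = vector_derivative (F r) (at t within T)"

definition parallel_to_velocity ::
    "'r set \<Rightarrow> real set \<Rightarrow> ('r \<Rightarrow> real \<Rightarrow> 'b::real_normed_vector) \<Rightarrow> bool" where
  "parallel_to_velocity \<Omega> T B \<longleftrightarrow>
     (\<forall>r\<in>\<Omega>. \<forall>t\<in>T. parallel (B r t) (time_derivative T B r t))"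

definition magnetization :: "(real \<Rightarrow> real) \<Rightarrow> real ^ 3 \<Rightarrow> real ^ 3" where
  "magnetization m b = (if b = 0 then 0 else (m (norm b) / norm b) *\<^sub>R b)"

(* The integrals of f and of its time derivative over \<Omega> exist at all times, and the time
   derivative may be interchanged with the integral. *)
definition differentiable_under_integral ::
    "(real ^ 3) set \<Rightarrow> real set \<Rightarrow> (real ^ 3 \<Rightarrow> real \<Rightarrow> real) \<Rightarrow> bool" where
  "differentiable_under_integral \<Omega> T f \<longleftrightarrow>
     (\<forall>t\<in>T. set_integrable lebesgue \<Omega> (\<lambda>r. f r t) \<and>
            set_integrable lebesgue \<Omega> (\<lambda>r. time_derivative T f r t) \<and>
            ((\<lambda>s. LINT r:\<Omega>|lebesgue. f r s) has_vector_derivative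
               (LINT r:\<Omega>|lebesgue. time_derivative T f r t)) (at t within T))"

end

theory Submission
  imports Defs
begin

text \<open>
  Away from the origin the magnetization is Frechet differentiable; its derivative acts
  as multiplication by \<open>m'(|b|)\<close> on the radial direction and by \<open>m(|b|) / |b|\<close>
  on the orthogonal complement, and only the radial part sees a velocity parallel to the field.
  At the origin \<open>m(0) = 0\<close> by oddness, so \<open>m(|h|) / |h|\<close> tends to \<open>m'(0)\<close>
  and the derivative is multiplication by \<open>m'(0)\<close> in every direction.
\<close>

lemma magnetization_has_derivative_0:
  assumes m0: "m 0 = 0" and m: "(m has_real_derivative D) (at 0)"
  shows "(magnetization m has_derivative (\<lambda>h. D *\<^sub>R h)) (at 0)"
proof -
  have "((\<lambda>x. m x / x) \<longlongrightarrow> D) (at 0)"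
    using m m0 by (simp add: has_field_derivative_iff)
  \<comment> \<open>Substituting \<open>norm b\<close> for \<open>x\<close> in a punctured limit
    requires that \<open>norm b\<close> tend to 0 without ever being 0.\<close>
  moreover have "filterlim norm (at (0::real)) (at (0 :: real ^ 3))"
    by (auto simp: filterlim_at eventually_at_filter intro!: tendsto_eq_intros)
  ultimately have "((\<lambda>b :: real ^ 3. m (norm b) / norm b) \<longlongrightarrow> D) (at 0)"
    by (rule filterlim_compose)
  then have lim: "((\<lambda>b :: real ^ 3. \<bar>m (norm b) / norm b - D\<bar>) \<longlongrightarrow> 0) (at 0)"
    using LIM_zero tendsto_rabs_zero by blast
  \<comment> \<open>The right-hand side is the Frechet remainder quotient at the origin, with
    \<open>0 + b\<close> kept to match its definition. The remainder is a scalar multiple of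
    \<open>b\<close>, so \<open>norm b\<close> cancels.\<close>
  have "\<forall>\<^sub>F b :: real ^ 3 in at 0. \<bar>m (norm b) / norm b - D\<bar> =
      norm (magnetization m (0 + b) - magnetization m 0 - D *\<^sub>R b) / norm b"
  proof (rule eventually_at_filter[THEN iffD2], rule always_eventually, intro allI impI)
    fix b :: "real ^ 3"
    assume "b \<noteq> 0"
    then have "magnetization m (0 + b) - magnetization m 0 - D *\<^sub>R b
        = (m (norm b) / norm b - D) *\<^sub>R b"
      by (simp add: magnetization_def scaleR_diff_left)
    with \<open>b \<noteq> 0\<close> show "\<bar>m (norm b) / norm b - D\<bar> =
        norm (magnetization m (0 + b) - magnetization m 0 - D *\<^sub>R b) / norm b"
      by simp
  qed
  from Lim_transform_eventually[OF lim this] show ?thesis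
    by (simp add: has_derivative_at bounded_linear_scaleR_right)
qed

text \<open>Product rule for \<open>(m (norm y) / norm y) *\<^sub>R y\<close>: the first summand
  differentiates the scalar quotient, the second the vector factor.\<close>

lemma magnetization_has_derivative_nonzero:
  assumes b: "b \<noteq> 0" and m: "(m has_real_derivative D) (at (norm b))"
  shows "(magnetization m has_derivative
    (\<lambda>h. ((D * (h \<bullet> sgn b)) / norm b - m (norm b) * (h \<bullet> sgn b) / (norm b)\<^sup>2) *\<^sub>R b
      + (m (norm b) / norm b) *\<^sub>R h)) (at b)"
proof -
  have n: "(norm has_derivative (\<lambda>h. h \<bullet> sgn b)) (at b)"
    using b by (rule has_derivative_norm)
  have "((\<lambda>y. m (norm y)) has_derivative (\<lambda>h. D * (h \<bullet> sgn b))) (at b)"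
    using has_derivative_compose[OF n m[unfolded has_field_derivative_def]] .
  from has_derivative_scaleR[OF has_derivative_divide[OF this n] has_derivative_ident] b
  have "((\<lambda>y. (m (norm y) / norm y) *\<^sub>R y) has_derivative
    (\<lambda>h. ((D * (h \<bullet> sgn b)) / norm b - m (norm b) * (h \<bullet> sgn b) / (norm b)\<^sup>2) *\<^sub>R b
      + (m (norm b) / norm b) *\<^sub>R h)) (at b)"
    by (simp add: field_simps power2_eq_square)
  \<comment> \<open>The complement of the origin is an open neighbourhood of \<open>b\<close> on
    which the conditional in \<open>magnetization\<close> always takes its second branch.\<close>
  then show ?thesis
  proof (rule has_derivative_transform_within_open)
    show "open (- {0 :: real ^ 3})" by (rule open_Compl) simp
  qed (use b in \<open>auto simp: magnetization_def\<close>)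
qed

lemma parallel_imp_scaleR:
  assumes "parallel b h" and "b \<noteq> 0"
  obtains k where "h = k *\<^sub>R b"
proof -
  obtain x y where xy: "x \<noteq> 0 \<or> y \<noteq> 0" "x *\<^sub>R b + y *\<^sub>R h = 0"
    using assms(1) by (auto simp: parallel_def)
  \<comment> \<open>If \<open>y\<close> were 0, then \<open>x\<close> would be nonzero and
    \<open>x *\<^sub>R b = 0\<close> would force \<open>b = 0\<close>.\<close>
  with assms(2) have "y \<noteq> 0" by auto
  have "y *\<^sub>R h = (- x) *\<^sub>R b"
    using xy(2) by (simp add: eq_neg_iff_add_eq_0 add.commute)
  then have "inverse y *\<^sub>R y *\<^sub>R h = inverse y *\<^sub>R (- x) *\<^sub>R b"
    by (rule arg_cong)
  then have "h = (inverse y * (- x)) *\<^sub>R b"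
    using \<open>y \<noteq> 0\<close> by simp
  then show thesis by (rule that)
qed

lemma magnetization_has_vector_derivative:
  assumes odd: "odd_function m" and m: "m differentiable_on UNIV"
    and f: "(f has_vector_derivative h) (at t within T)"
    and par: "parallel (f t) h"
  shows "((\<lambda>s. magnetization m (f s)) has_vector_derivative deriv m (norm (f t)) *\<^sub>R h)
    (at t within T)"
proof -
  have D: "(m has_real_derivative deriv m x) (at x)" for x
    using m by (simp add: differentiable_on_def DERIV_deriv_iff_real_differentiable)
  \<comment> \<open>The chain rule needs the Frechet derivative only through its value at
    \<open>h\<close>, so both cases can be merged under one existential.\<close>
  have "\<exists>M'. (magnetization m has_derivative M') (at (f t)) \<and> M' h = deriv m (norm (f t)) *\<^sub>R h"
  proof (cases "f t = 0")
    case True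
    have "m 0 = 0"
      using odd[unfolded odd_function_def, rule_format, of 0] by simp
    with magnetization_has_derivative_0[OF _ D] True show ?thesis by auto
  next
    case False
    obtain k where k: "h = k *\<^sub>R f t"
      using parallel_imp_scaleR[OF par False] .
    have radial: "f t \<bullet> sgn (f t) = norm (f t)"
      using False by (simp add: sgn_div_norm power2_eq_square flip: power2_norm_eq_inner)
    \<comment> \<open>For \<open>h = k *\<^sub>R f t\<close> the two terms containing
      \<open>m (norm (f t))\<close> cancel, leaving \<open>D * k\<close> times \<open>f t\<close>,
      where \<open>D\<close> is the derivative of \<open>m\<close> at
      \<open>norm (f t)\<close>.\<close>
    from magnetization_has_derivative_nonzero[OF False D] show ?thesis
      by (intro exI conjI)
        (assumption, use False radial in \<open>simp add: k power2_eq_square scaleR_diff_left\<close>)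
  qed
  then obtain M' where M': "(magnetization m has_derivative M') (at (f t))"
      "M' h = deriv m (norm (f t)) *\<^sub>R h" by blast
  have "((\<lambda>s. magnetization m (f s)) has_derivative (\<lambda>x. M' (x *\<^sub>R h))) (at t within T)"
    using has_derivative_compose[OF f[unfolded has_vector_derivative_def] M'(1)] .
  moreover have "M' (x *\<^sub>R h) = x *\<^sub>R (deriv m (norm (f t)) *\<^sub>R h)" for x
    using linear_scale[OF has_derivative_linear[OF M'(1)]] M'(2) by simp
  ultimately show ?thesis
    by (simp add: has_vector_derivative_def)
qed

text \<open>A connected set with more than one point has no isolated points, and nonempty interior
  excludes singletons. This makes derivatives within \<open>T\<close> unique, so they can be equated
  with \<open>vector_derivative\<close>.\<close>

lemma at_within_interval_neq_bot:
  fixes T :: "real set"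
  assumes "is_interval T" and "interior T \<noteq> {}" and "t \<in> T"
  shows "at t within T \<noteq> bot"
proof -
  have "T \<noteq> {x}" for x
    using assms(2) by auto
  then have "t islimpt T"
    using assms by (intro connected_imp_perfect) (auto simp: is_interval_connected_1)
  then show ?thesis
    by (simp add: trivial_limit_within)
qed

theorem theorem4p1:
  fixes \<Omega> :: "(real ^ 3) set"
    and T :: "real set"
    and m :: "real \<Rightarrow> real"
    and B :: "real ^ 3 \<Rightarrow> real \<Rightarrow> real ^ 3"
    and \<mu>\<^sub>0 :: real
    and V :: nat
    and \<rho> :: "nat \<Rightarrow> real ^ 3 \<Rightarrow> real ^ 3"
    and c :: "real ^ 3 \<Rightarrow> real"
    and u :: "nat \<Rightarrow> real \<Rightarrow> real"
  assumes "is_interval T" and "interior T \<noteq> {}"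
    and "odd_function m"
    and "twice_continuously_differentiable m"
    and "\<And>r. r \<in> \<Omega> \<Longrightarrow> B r differentiable_on T"
    and "parallel_to_velocity \<Omega> T B"
    and "\<mu>\<^sub>0 > 0"
  shows "(\<forall>r\<in>\<Omega>. \<forall>t\<in>T.
            ((\<lambda>s. magnetization m (B r s)) has_vector_derivative
               deriv m (norm (B r t)) *\<^sub>R time_derivative T B r t) (at t within T))
       \<and> (\<forall>\<nu>\<in>{1..V}.
            differentiable_under_integral \<Omega> T (\<lambda>r s. (\<rho> \<nu> r \<bullet> magnetization m (B r s)) * c r) \<longrightarrow>
            (\<forall>t\<in>T.
               u \<nu> t = - \<mu>\<^sub>0 * vector_derivative
                   (\<lambda>s. LINT r:\<Omega>|lebesgue. (\<rho> \<nu> r \<bullet> magnetization m (B r s)) * c r) (at t within T)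
               \<longleftrightarrow>
               u \<nu> t = - \<mu>\<^sub>0 * (LINT r:\<Omega>|lebesgue.
                   (\<rho> \<nu> r \<bullet> time_derivative T B r t) * deriv m (norm (B r t)) * c r)))"
proof -
  let ?B' = "time_derivative T B"
  have m: "m differentiable_on UNIV"
    using assms(4) by (auto simp: twice_continuously_differentiable_def
        intro: C1_diff_imp_diff)
  have nontriv: "at t within T \<noteq> bot" if "t \<in> T" for t
    using at_within_interval_neq_bot[OF assms(1,2) that] .
  have M: "((\<lambda>s. magnetization m (B r s)) has_vector_derivative
      deriv m (norm (B r t)) *\<^sub>R ?B' r t) (at t within T)" if "r \<in> \<Omega>" "t \<in> T" for r t
  proof (rule magnetization_has_vector_derivative[OF assms(3) m])
    show "(B r has_vector_derivative ?B' r t) (at t within T)"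
      using assms(5)[OF that(1)] that(2)
      unfolding time_derivative_def differentiable_on_def
      by (intro vector_derivative_works[THEN iffD1]) blast
    show "parallel (B r t) (?B' r t)"
      using assms(6) that by (auto simp: parallel_to_velocity_def)
  qed
  \<comment> \<open>The two formulas for the voltage differ only in this factor, so equating the
    factors gives the equivalence for arbitrary \<open>u\<close>.\<close>
  have "vector_derivative
          (\<lambda>s. LINT r:\<Omega>|lebesgue. (\<rho> \<nu> r \<bullet> magnetization m (B r s)) * c r) (at t within T)
      = (LINT r:\<Omega>|lebesgue. (\<rho> \<nu> r \<bullet> ?B' r t) * deriv m (norm (B r t)) * c r)"
    if diff: "differentiable_under_integral \<Omega> T
        (\<lambda>r s. (\<rho> \<nu> r \<bullet> magnetization m (B r s)) * c r)" and t: "t \<in> T" for \<nu> t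
  proof -
    let ?f = "\<lambda>r s. (\<rho> \<nu> r \<bullet> magnetization m (B r s)) * c r"
    have f': "time_derivative T ?f r t = (\<rho> \<nu> r \<bullet> ?B' r t) * deriv m (norm (B r t)) * c r"
      if r: "r \<in> \<Omega>" for r
    proof -
      \<comment> \<open>At fixed \<open>r\<close>, pairing with \<open>\<rho> \<nu> r\<close> and
        multiplying by \<open>c r\<close> are bounded linear maps, which commute with the time
        derivative.\<close>
      have "((\<lambda>s. ?f r s) has_vector_derivative
          (\<rho> \<nu> r \<bullet> (deriv m (norm (B r t)) *\<^sub>R ?B' r t)) * c r) (at t within T)"
        using bounded_linear.has_vector_derivative[OF bounded_linear_mult_left
            bounded_linear.has_vector_derivative[OF bounded_linear_inner_right M[OF r t]]] .
      from vector_derivative_within[OF nontriv[OF t] this] show ?thesis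
        by (simp add: time_derivative_def mult_ac)
    qed
    have "vector_derivative (\<lambda>s. LINT r:\<Omega>|lebesgue. ?f r s) (at t within T)
        = (LINT r:\<Omega>|lebesgue. time_derivative T ?f r t)"
      using diff t by (intro vector_derivative_within[OF nontriv[OF t]])
        (simp add: differentiable_under_integral_def)
    also have "\<dots> = (LINT r:\<Omega>|lebesgue. (\<rho> \<nu> r \<bullet> ?B' r t) * deriv m (norm (B r t)) * c r)"
      \<comment> \<open>The integrands are known to agree only on \<open>\<Omega>\<close>; the
        indicator annihilates both elsewhere.\<close>
      unfolding set_lebesgue_integral_def
      by (rule Bochner_Integration.integral_cong[OF refl]) (simp add: f' indicator_def)
    finally show ?thesis .
  qed
  with M show ?thesis by simp
qed

end
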